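(* Let $m=8k-1$ be a positive prime number. The group $\Delta^m_{(2)}$ embeds in the group $\mathrm{SO}^+(F_4;\mathbb{Z})_{(2)}$, the index $2$ subgroup of orientation-preserving elements of the right-angled Coxeter group $\mathrm{O}^+(F_4;\mathbb{Z})_{(2)}$.
   Context: For a real quadratic form $Q$ of signature $(n,1)$ in $n+1$ variables, given in coordinates as a diagonal form whose first coordinate is the negative one, let $S_Q$ be its symmetric matrix. $\mathrm{O}(Q;\mathbb{R})=\{M\in\mathrm{GL}(n+1,\mathbb{R}): M^tS_QM=S_Q\}$; $\mathrm{O}^+(Q;\mathbb{R})$ is the index $2$ subgroup preserving the positive sheet (the vectors with positive first coordinate) of the two-sheeted hyperboloid $\{Q=-1\}$; $\mathrm{SO}^+(Q;\mathbb{R})$ is its subgroup of matrices of determinant $1$. $\mathrm{O}^+(Q;\mathbb{Z})$ and $\mathrm{SO}^+(Q;\mathbb{Z})$ denote the intersections with $\mathrm{GL}(n+1,\mathbb{Z})$. For a group $\Delta$ of integral matrices, $\Delta_{(2)}$ denotes the subgroup of matrices in $\Delta$ congruent to the identity modulo $2$. $F_4=-x_0^2+x_1^2+x_2^2+x_3^2+x_4^2$. It is known that $\mathrm{O}^+(F_4;\mathbb{Z})_{(2)}$ is a right-angled Coxeter group (the reflection group of an all-right hyperbolic polytope of dimension $4$) with $\mathrm{SO}^+(F_4;\mathbb{Z})_{(2)}$ as its index $2$ orientation-preserving subgroup. $Q'_m=-mx_1^2+x_2^2+x_3^2+x_4^2$, and $\Delta^m$ is the index $2$ subgroup of $\mathrm{SO}^+(Q'_m;\mathbb{Z})$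 consisting of the elements whose $(1,1)$-matrix entry is congruent to $1$ modulo $m$. "Embeds" means that there is an injective group homomorphism. *)

theory Defs
  imports
    "Jordan_Normal_Form.Determinant"
    "HOL-Algebra.Coset"
    "HOL-Library.Real_Mod"
begin

text \<open>A diagonal quadratic form is given by the list of its coefficients; \<open>cs ! i\<close> is the
  coefficient of the square of the coordinate with index \<open>i\<close>. Coordinates are counted from 0, so the
  first (negative) coordinate of the forms below always has index 0.\<close>

definition quad_form :: "real list \<Rightarrow> real vec \<Rightarrow> real" where
  "quad_form cs x = (\<Sum>i<length cs. cs ! i * (x $ i)\<^sup>2)"

definition form_matrix :: "real list \<Rightarrow> real mat" where
  "form_matrix cs = mat_diag (length cs) (\<lambda>i. cs ! i)"

definition GL_real :: "nat \<Rightarrow> real mat monoid" where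
  "GL_real n = units_of (ring_mat TYPE(real) n ())"

text \<open>The matrices in \<open>GL(n, \<int>)\<close>, i.e. the integral matrices with an integral inverse, as real
  matrices.\<close>

definition GL_int :: "nat \<Rightarrow> real mat set" where
  "GL_int n = map_mat real_of_int ` Units (ring_mat TYPE(int) n ())"

definition O_real :: "real list \<Rightarrow> real mat set" where
  "O_real cs = {M \<in> carrier (GL_real (length cs)).
     M\<^sup>T * form_matrix cs * M = form_matrix cs}"

definition positive_sheet :: "real list \<Rightarrow> real vec set" where
  "positive_sheet cs = {x \<in> carrier_vec (length cs). quad_form cs x = - 1 \<and> x $ 0 > 0}"

definition O_plus_real :: "real list \<Rightarrow> real mat set" where
  "O_plus_real cs = {M \<in> O_real cs. (\<lambda>x. M *\<^sub>v x) ` positive_sheet cs = positive_sheet cs}"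

definition SO_plus_real :: "real list \<Rightarrow> real mat set" where
  "SO_plus_real cs = {M \<in> O_plus_real cs. det M = 1}"

definition O_plus_int :: "real list \<Rightarrow> real mat set" where
  "O_plus_int cs = O_plus_real cs \<inter> GL_int (length cs)"

definition SO_plus_int :: "real list \<Rightarrow> real mat set" where
  "SO_plus_int cs = SO_plus_real cs \<inter> GL_int (length cs)"

text \<open>The elements congruent to the identity modulo 2. For real numbers, \<open>[a = b] (rmod 2)\<close> says
  that \<open>a - b\<close> is an integer multiple of 2.\<close>

definition congruence_subgroup2 :: "nat \<Rightarrow> real mat set \<Rightarrow> real mat set" where
  "congruence_subgroup2 n D =
     {M \<in> D. \<forall>i<n. \<forall>j<n. [M $$ (i, j) = 1\<^sub>m n $$ (i, j)] (rmod 2)}"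

definition matrix_group :: "nat \<Rightarrow> real mat set \<Rightarrow> real mat monoid" where
  "matrix_group n D = (GL_real n)\<lparr>carrier := D\<rparr>"

definition F4 :: "real list" where
  "F4 = [- 1, 1, 1, 1, 1]"

definition Q' :: "int \<Rightarrow> real list" where
  "Q' m = [- real_of_int m, 1, 1, 1]"

definition Delta :: "int \<Rightarrow> real mat set" where
  "Delta m = {M \<in> SO_plus_int (Q' m). [M $$ (0, 0) = 1] (rmod real_of_int m)}"

definition group_embeds :: "('a, 'c) monoid_scheme \<Rightarrow> ('b, 'd) monoid_scheme \<Rightarrow> bool" where
  "group_embeds G H \<longleftrightarrow> (\<exists>f. f \<in> mon G H)"

end

(* Let P = frame m, which carries the form <m> + Q'_m to F_4 over the rationals, and let M' be M
   extended by 1 on the summand <m>. The image of M is P M' P^(-1) = 1 + P (M' - 1) P^(-1). P is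
   integral, and P^(-1) has denominators m only in the coordinates of the plane spanned by <m> and
   the negative vector; since M' - 1 vanishes on <m>, only the first column of M - 1 meets these
   denominators. Its entries are divisible by m: the corner entry by the definition of Delta m, the
   others because the inverse of the isometry M is integral. They are also even, hence divisible by
   2 m as m is odd. The image preserves the positive sheet because its corner entry is positive. *)
theory Submission
  imports Defs "HOL-Analysis.L2_Norm"
begin

section \<open>Integrality and integral matrices\<close>

lemma rcong_iff_Ints:
  assumes "c \<noteq> 0"
  shows "[x = y] (rmod c) \<longleftrightarrow> (x - y) / c \<in> \<int>"
proof -
  have "[x = y] (rmod c) \<longleftrightarrow> [y = x] (rmod c)" by (rule rcong_sym_iff)
  also have "\<dots> \<longleftrightarrow> (\<exists>n. x = y + of_int n * c)" by (rule rcong_altdef)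
  also have "\<dots> \<longleftrightarrow> (\<exists>n. (x - y) / c = of_int n)"
    using assms by (intro ex_cong1) (auto simp: field_simps)
  finally show ?thesis by (auto simp: Ints_def)
qed

text \<open>With \<open>x = a * u = b * v\<close>, coprimality forces \<open>a\<close> to divide
  \<open>v\<close>. It merges divisibility by 2 with divisibility by \<open>m\<close>.\<close>

lemma Ints_divide_coprime:
  fixes x :: real and a b :: int
  assumes "x / a \<in> \<int>" "x / b \<in> \<int>" "coprime a b" "a \<noteq> 0" "b \<noteq> 0"
  shows "x / (a * b) \<in> \<int>"
proof -
  from assms obtain u v :: int where x: "x = a * u" "x = b * v"
  proof -
    from assms(1,2) obtain u v where "x / a = of_int u" "x / b = of_int v" by (elim Ints_cases)
    with assms(4,5) that[of u v] show thesis by (simp add: field_simps)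
  qed
  then have "real_of_int (a * u) = real_of_int (b * v)" by simp
  then have "a * u = b * v" by (simp only: of_int_eq_iff)
  then have "a dvd v" using assms(3) by (metis coprime_dvd_mult_right_iff dvd_triv_left)
  then obtain w where "v = a * w" ..
  then have "x / (a * b) = w" using x assms by simp
  then show ?thesis by simp
qed

text \<open>The entries are integers, so taking floors only changes their type; with determinant 1
  the adjugate is an integral inverse.\<close>

lemma GL_intI:
  assumes A: "A \<in> carrier_mat n n" and Z: "\<And>i j. i < n \<Longrightarrow> j < n \<Longrightarrow> A $$ (i, j) \<in> \<int>"
    and det: "det A = 1"
  shows "A \<in> GL_int n"
proof -
  define B where "B = map_mat floor A"
  have B: "B \<in> carrier_mat n n" using A by (simp add: B_def)
  have AB: "A = map_mat real_of_int B"
    using A Z by (intro eq_matI) (auto simp: B_def)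
  have "real_of_int (det B) = 1" using det unfolding AB by simp
  then have "det B = 1" by simp
  then have "B * adj_mat B = 1\<^sub>m n" "adj_mat B * B = 1\<^sub>m n" "adj_mat B \<in> carrier_mat n n"
    using adj_mat[OF B] by auto
  then have "B \<in> Units (ring_mat TYPE(int) n ())"
    using B by (auto simp: Units_def ring_mat_simps)
  then show ?thesis by (auto simp: GL_int_def AB)
qed

lemma GL_intE:
  assumes "A \<in> GL_int n"
  obtains B where "A \<in> carrier_mat n n" "B \<in> carrier_mat n n" "A * B = 1\<^sub>m n"
    "\<And>i j. i < n \<Longrightarrow> j < n \<Longrightarrow> A $$ (i, j) \<in> \<int>" "\<And>i j. i < n \<Longrightarrow> j < n \<Longrightarrow> B $$ (i, j) \<in> \<int>"
proof -
  from assms obtain A' B' where AB: "A = map_mat real_of_int A'" "A' \<in> carrier_mat n n"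
    "B' \<in> carrier_mat n n" "A' * B' = 1\<^sub>m n"
    by (auto simp: GL_int_def Units_def ring_mat_simps)
  then have "A * map_mat real_of_int B' = 1\<^sub>m n"
    using of_int_hom.mat_hom_mult[OF AB(2,3), where ?'a = real] by (simp add: of_int_hom.mat_hom_one)
  with AB show ?thesis by (intro that[of "map_mat real_of_int B'"]) auto
qed

section \<open>Isometries of a diagonal form\<close>

lemma form_matrix_carrier [simp]: "form_matrix cs \<in> carrier_mat (length cs) (length cs)"
  by (simp add: form_matrix_def)

lemma form_matrix_dim [simp]:
  "dim_row (form_matrix cs) = length cs" "dim_col (form_matrix cs) = length cs"
  by (simp_all add: form_matrix_def mat_diag_def)

lemma form_matrix_transpose [simp]: "(form_matrix cs)\<^sup>T = form_matrix cs"
  by (rule eq_matI) (auto simp: form_matrix_def mat_diag_def)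

lemma O_realI:
  assumes "M \<in> carrier_mat (length cs) (length cs)" "det M \<noteq> 0"
    "M\<^sup>T * form_matrix cs * M = form_matrix cs"
  shows "M \<in> O_real cs"
  using assms det_non_zero_imp_unit[OF assms(1,2)]
  by (auto simp: O_real_def GL_real_def units_of_def)

lemma O_realD:
  assumes "M \<in> O_real cs"
  shows "M \<in> carrier_mat (length cs) (length cs)" "M\<^sup>T * form_matrix cs * M = form_matrix cs"
  using assms by (auto simp: O_real_def GL_real_def units_of_def Units_def ring_mat_simps)

lemma quad_form_eq_scalar_prod:
  assumes "x \<in> carrier_vec (length cs)"
  shows "quad_form cs x = x \<bullet> (form_matrix cs *\<^sub>v x)"
proof -
  have "(form_matrix cs *\<^sub>v x) $ i = cs ! i * x $ i" if "i < length cs" for i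
    using that assms
    by (auto simp: form_matrix_def mat_diag_def scalar_prod_def if_distrib if_distribR
        sum.remove[of "{0..<length cs}" i] cong: if_cong)
  then show ?thesis
    by (auto simp: quad_form_def scalar_prod_def power2_eq_square lessThan_atLeast0 intro!: sum.cong)
qed

lemma quad_form_O_real:
  assumes M: "M \<in> O_real cs" and x: "x \<in> carrier_vec (length cs)"
  shows "quad_form cs (M *\<^sub>v x) = quad_form cs x"
proof -
  note MD = O_realD[OF M]
  let ?S = "form_matrix cs" and ?n = "length cs"
  have Mx: "M *\<^sub>v x \<in> carrier_vec ?n" using MD x by simp
  have "quad_form cs x = x \<bullet> ((M\<^sup>T * (?S * M)) *\<^sub>v x)"
    using MD quad_form_eq_scalar_prod[OF x]
    by (simp add: assoc_mult_mat[of _ ?n ?n _ ?n _ ?n])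
  also have "\<dots> = x \<bullet> (M\<^sup>T *\<^sub>v (?S *\<^sub>v (M *\<^sub>v x)))"
    using MD x by (simp add: assoc_mult_mat_vec[of _ ?n ?n _ ?n] mult_carrier_mat[of _ ?n ?n])
  also have "\<dots> = (M\<^sup>T *\<^sub>v (?S *\<^sub>v (M *\<^sub>v x))) \<bullet> x"
    using MD x by (intro comm_scalar_prod[of _ ?n]) (auto simp: mult_mat_vec_carrier[of _ ?n ?n])
  also have "\<dots> = (?S *\<^sub>v (M *\<^sub>v x)) \<bullet> (M *\<^sub>v x)"
    using MD x Mx by (intro transpose_vec_mult_scalar[of _ ?n ?n] mult_mat_vec_carrier[of _ _ ?n]) auto
  also have "\<dots> = quad_form cs (M *\<^sub>v x)"
    using Mx comm_scalar_prod[of "M *\<^sub>v x" ?n "?S *\<^sub>v (M *\<^sub>v x)"]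
    by (simp add: quad_form_eq_scalar_prod mult_mat_vec_carrier[of _ ?n ?n])
  finally show ?thesis by simp
qed

text \<open>Multiplying \<open>M\<^sup>T * S * M = S\<close> on the left by \<open>W\<^sup>T\<close>
  gives \<open>S * M = W\<^sup>T * S\<close>; the claim compares entries. If \<open>W\<close> is
  integral, this yields divisibilities between entries of \<open>M\<close> and coefficients of the
  form.\<close>

lemma O_real_inverse_entry:
  assumes M: "M \<in> O_real cs" and W: "W \<in> carrier_mat (length cs) (length cs)" "M * W = 1\<^sub>m (length cs)"
    and ij: "i < length cs" "j < length cs"
  shows "cs ! i * M $$ (i, j) = W $$ (j, i) * cs ! j"
proof -
  note MD = O_realD[OF M]
  let ?S = "form_matrix cs" and ?n = "length cs"
  have "W\<^sup>T * M\<^sup>T = 1\<^sub>m ?n" using W MD by (metis transpose_mult transpose_one)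
  then have "?S * M = (W\<^sup>T * M\<^sup>T) * (?S * M)" using MD by simp
  also have "\<dots> = W\<^sup>T * (M\<^sup>T * ?S * M)"
    using MD W mult_carrier_mat[of ?S ?n ?n M ?n] by (simp add: assoc_mult_mat[of _ ?n ?n _ ?n _ ?n])
  finally have "?S * M = W\<^sup>T * ?S" using MD by simp
  then have "(?S * M) $$ (i, j) = (W\<^sup>T * ?S) $$ (i, j)" by simp
  then show ?thesis using ij W MD
    by (simp add: form_matrix_def mat_diag_mult_left[of _ ?n ?n] mat_diag_mult_right[of _ ?n ?n])
qed

section \<open>The positive sheet of a Lorentzian form\<close>

lemma quad_form_lorentzian:
  "quad_form (- 1 # replicate n 1) x = (\<Sum>i<n. (x $ Suc i)\<^sup>2) - (x $ 0)\<^sup>2"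
  unfolding quad_form_def length_Cons length_replicate sum.lessThan_Suc_shift by simp

text \<open>On the sheet the spatial part of \<open>x\<close> has norm
  \<open>sqrt ((x $ 0)\<^sup>2 - 1)\<close>, which is less than \<open>x $ 0\<close>. By
  Cauchy-Schwarz the spatial part of the product is therefore smaller in absolute value than
  \<open>x $ 0 * y $ 0\<close>. The product is the Euclidean one because it serves for a matrix row
  times a vector.\<close>

lemma positive_sheet_scalar_prod_pos:
  assumes "x \<in> positive_sheet (- 1 # replicate n 1)" "y \<in> positive_sheet (- 1 # replicate n 1)"
  shows "0 < x \<bullet> y"
proof -
  let ?s = "\<Sum>i<n. x $ Suc i * y $ Suc i"
  have x: "(\<Sum>i<n. (x $ Suc i)\<^sup>2) = (x $ 0)\<^sup>2 - 1" "0 < x $ 0"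
   and y: "(\<Sum>i<n. (y $ Suc i)\<^sup>2) = (y $ 0)\<^sup>2 - 1" "0 < y $ 0" "dim_vec y = Suc n"
    using assms by (auto simp: positive_sheet_def quad_form_lorentzian)
  have "\<bar>?s\<bar> \<le> (\<Sum>i<n. \<bar>x $ Suc i\<bar> * \<bar>y $ Suc i\<bar>)"
    using sum_abs[of "\<lambda>i. x $ Suc i * y $ Suc i" "{..<n}"] by (simp add: abs_mult)
  also have "\<dots> \<le> sqrt ((x $ 0)\<^sup>2 - 1) * sqrt ((y $ 0)\<^sup>2 - 1)"
    using L2_set_mult_ineq[of "\<lambda>i. x $ Suc i" "\<lambda>i. y $ Suc i" "{..<n}"]
    by (simp add: L2_set_def x y)
  also have "\<dots> < x $ 0 * y $ 0"
  proof (rule mult_strict_mono')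
    show "sqrt ((x $ 0)\<^sup>2 - 1) < x $ 0" "sqrt ((y $ 0)\<^sup>2 - 1) < y $ 0"
      using x(2) y(2) by (auto intro: real_less_lsqrt)
    show "0 \<le> sqrt ((x $ 0)\<^sup>2 - 1)" "0 \<le> sqrt ((y $ 0)\<^sup>2 - 1)"
      unfolding x(1)[symmetric] y(1)[symmetric] by (auto intro: sum_nonneg)
  qed
  finally have "\<bar>?s\<bar> < x $ 0 * y $ 0" .
  moreover have "x \<bullet> y = x $ 0 * y $ 0 + ?s"
    using y unfolding scalar_prod_def by (simp only: sum.lessThan_Suc_shift flip: lessThan_atLeast0)
  ultimately show ?thesis by linarith
qed

text \<open>As \<open>S\<close> is its own inverse, \<open>S * A\<^sup>T * S\<close> is a left
  inverse of \<open>A\<close>, hence a two-sided one. Cancelling \<open>S\<close> then shows that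
  the transpose is an isometry too, so that rows of \<open>A\<close> can be treated like
  columns.\<close>

lemma involutive_form_isometry:
  fixes S A :: "real mat"
  assumes S: "S \<in> carrier_mat n n" and A: "A \<in> carrier_mat n n"
    and SS: "S * S = 1\<^sub>m n" and ASA: "A\<^sup>T * S * A = S"
  shows "(S * A\<^sup>T * S) * A = 1\<^sub>m n" "A * (S * A\<^sup>T * S) = 1\<^sub>m n" "A * S * A\<^sup>T = S"
proof -
  have "(S * A\<^sup>T * S) * A = S * (A\<^sup>T * S * A)"
    using S A by (simp add: assoc_mult_mat[of _ n n _ n _ n])
  then show left: "(S * A\<^sup>T * S) * A = 1\<^sub>m n" using ASA SS by simp
  show right: "A * (S * A\<^sup>T * S) = 1\<^sub>m n"
    using S A by (intro mat_mult_left_right_inverse[OF _ A left]) auto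
  have "S = (A * (S * A\<^sup>T * S)) * S"
    unfolding right using S by (simp add: left_mult_one_mat[of _ n n])
  also have "\<dots> = (A * S * A\<^sup>T) * (S * S)"
    using S A by (simp add: assoc_mult_mat[of _ n n _ n _ n])
  also have "\<dots> = A * S * A\<^sup>T"
    unfolding SS using S A by (intro right_mult_one_mat[of _ n n]) auto
  finally show "A * S * A\<^sup>T = S" by simp
qed

text \<open>The first coordinate of \<open>N *\<^sub>v x\<close> is
  \<open>row N 0 \<bullet> x\<close>. Row 0 of \<open>N\<close> lies on the sheet itself, so this
  product is positive and \<open>N\<close> maps the sheet into itself. Equality follows because the
  inverse of \<open>N\<close> has the same corner entry.\<close>

lemma O_plus_realI:
  fixes n defines "cs \<equiv> - 1 # replicate n 1"
  assumes N: "N \<in> O_real cs" and pos: "0 < N $$ (0, 0)"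
  shows "N \<in> O_plus_real cs"
proof -
  let ?S = "form_matrix cs" and ?n = "Suc n"
  have len: "length cs = ?n" by (simp add: cs_def)
  note ND = O_realD[OF N, unfolded len]
  have S: "?S \<in> carrier_mat ?n ?n" using form_matrix_carrier[of cs] len by simp
  have SS: "?S * ?S = 1\<^sub>m ?n"
    unfolding form_matrix_def mat_diag_diag
    by (rule eq_matI) (auto simp: mat_diag_def cs_def nth_Cons split: nat.split)
  define R where "R = ?S * N\<^sup>T * ?S"
  have R: "R \<in> carrier_mat ?n ?n" using S ND by (auto simp: R_def)
  note RN = involutive_form_isometry(1)[OF S ND(1) SS ND(2), folded R_def]
   and NR = involutive_form_isometry(2)[OF S ND(1) SS ND(2), folded R_def]
   and NSN = involutive_form_isometry(3)[OF S ND(1) SS ND(2)]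
  \<comment> \<open>The three inner copies of \<open>?S\<close> collapse to one, and then
    \<open>N * ?S * N\<^sup>T = ?S\<close> applies.\<close>
  have RtSR: "R\<^sup>T * ?S * R = ?S"
  proof -
    have "R\<^sup>T = ?S * N * ?S"
      unfolding R_def using S ND
      by (simp add: transpose_mult[of _ ?n ?n _ ?n] assoc_mult_mat[of _ ?n ?n _ ?n _ ?n])
    then have "R\<^sup>T * ?S * R = ?S * N * (?S * ?S * ?S) * N\<^sup>T * ?S"
      unfolding R_def using S ND by (simp add: assoc_mult_mat[of _ ?n ?n _ ?n _ ?n])
    also have "\<dots> = ?S * (N * ?S * N\<^sup>T) * ?S"
      unfolding SS left_mult_one_mat[OF S] using S ND by (simp add: assoc_mult_mat[of _ ?n ?n _ ?n _ ?n])
    finally show ?thesis using NSN SS left_mult_one_mat[OF S] by simp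
  qed
  have "det R \<noteq> 0" using RN R ND det_mult[of R ?n N] by auto
  then have RO: "R \<in> O_real cs" using R RtSR by (intro O_realI) (auto simp: len)
  \<comment> \<open>The corner entry picks up the sign -1 twice.\<close>
  have R00: "R $$ (0, 0) = N $$ (0, 0)"
    unfolding R_def using S ND
    by (simp add: form_matrix_def len mat_diag_mult_left[of _ ?n ?n] mat_diag_mult_right[of _ ?n ?n])
      (simp add: cs_def)
  \<comment> \<open>The form takes on row 0 the value of the corner entry of
    \<open>A * ?S * A\<^sup>T\<close>, which is -1.\<close>
  have row_sheet: "row A 0 \<in> positive_sheet cs"
    if A: "A \<in> carrier_mat ?n ?n" "A * ?S * A\<^sup>T = ?S" "0 < A $$ (0, 0)" for A
  proof -
    have "quad_form cs (row A 0) = row A 0 \<bullet> (?S *\<^sub>v col (A\<^sup>T) 0)"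
      using A quad_form_eq_scalar_prod[of "row A 0" cs] row_carrier_vec[of 0 ?n A ?n] by (simp add: len)
    also have "\<dots> = (A * (?S * A\<^sup>T)) $$ (0, 0)"
      using A(1) S by (simp add: col_mult2[of _ ?n ?n _ ?n] mult_mat_vec_def len)
    also have "\<dots> = ?S $$ (0, 0)" using A S by (metis assoc_mult_mat transpose_carrier_mat)
    also have "\<dots> = - 1" using len by (simp add: form_matrix_def mat_diag_def cs_def)
    finally show ?thesis using A row_carrier_vec[of 0 ?n A ?n] by (simp add: positive_sheet_def len)
  qed
  note RSR = involutive_form_isometry(3)[OF S R SS RtSR]
  have maps: "A *\<^sub>v x \<in> positive_sheet cs"
    if A: "A \<in> O_real cs" "A * ?S * A\<^sup>T = ?S" "0 < A $$ (0, 0)" and x: "x \<in> positive_sheet cs" for A x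
  proof -
    have "row A 0 \<in> positive_sheet cs" using row_sheet O_realD(1)[OF A(1)] A(2,3) len by simp
    with x have "0 < row A 0 \<bullet> x" unfolding cs_def by (intro positive_sheet_scalar_prod_pos)
    then show ?thesis
      using x quad_form_O_real[OF A(1)] O_realD[OF A(1)] by (auto simp: positive_sheet_def len)
  qed
  have "(\<lambda>x. N *\<^sub>v x) ` positive_sheet cs = positive_sheet cs"
  proof (intro equalityI subsetI)
    fix x assume x: "x \<in> positive_sheet cs"
    then have "N *\<^sub>v (R *\<^sub>v x) = x"
      using assoc_mult_mat_vec[OF ND(1) R, of x] NR by (simp add: positive_sheet_def len)
    moreover have "R *\<^sub>v x \<in> positive_sheet cs" using maps[OF RO RSR] x R00 pos by simp
    ultimately show "x \<in> (\<lambda>x. N *\<^sub>v x) ` positive_sheet cs" by (metis imageI)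
  qed (use maps N NSN pos in auto)
  with N show ?thesis by (simp add: O_plus_real_def)
qed

text \<open>The first basis vector, scaled by \<open>c\<close> so that the form takes the value -1,
  lies on the sheet; the first coordinate of its image is \<open>c\<close> times the corner
  entry.\<close>

lemma O_plus_real_corner_pos:
  assumes "M \<in> O_plus_real cs" "cs \<noteq> []" "cs ! 0 < 0"
  shows "0 < M $$ (0, 0)"
proof -
  let ?n = "length cs"
  define c where "c = 1 / sqrt (- (cs ! 0))"
  define x where "x = c \<cdot>\<^sub>v unit_vec ?n 0"
  have c: "0 < c" "cs ! 0 * c\<^sup>2 = - 1"
    using assms by (auto simp: c_def power_divide)
  have M: "M \<in> carrier_mat ?n ?n" using assms O_realD by (auto simp: O_plus_real_def)
  have "quad_form cs x = cs ! 0 * c\<^sup>2"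
    using assms by (auto simp: quad_form_def x_def unit_vec_def if_distrib sum.remove[of _ 0])
  then have "x \<in> positive_sheet cs" using c assms by (simp add: positive_sheet_def x_def)
  then have "M *\<^sub>v x \<in> positive_sheet cs" using assms(1) by (auto simp: O_plus_real_def)
  then have "0 < (M *\<^sub>v x) $ 0" by (simp add: positive_sheet_def)
  also have "(M *\<^sub>v x) $ 0 = c * M $$ (0, 0)"
    using M assms by (simp add: x_def)
  finally show ?thesis using c by (simp add: zero_less_mult_iff)
qed

section \<open>Adding a fixed coordinate in front\<close>

definition stabilize :: "real mat \<Rightarrow> real mat" where
  "stabilize M = four_block_mat (1\<^sub>m 1) (0\<^sub>m 1 (dim_col M)) (0\<^sub>m (dim_row M) 1) M"

lemma stabilize_carrier [simp]: "M \<in> carrier_mat n n \<Longrightarrow> stabilize M \<in> carrier_mat (Suc n) (Suc n)"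
  unfolding stabilize_def by (metis carrier_matD four_block_carrier_mat one_carrier_mat plus_1_eq_Suc)

lemma stabilize_index:
  assumes "M \<in> carrier_mat n n" "i < Suc n" "j < Suc n"
  shows "stabilize M $$ (i, j) =
    (if i = 0 \<or> j = 0 then if i = j then 1 else 0 else M $$ (i - 1, j - 1))"
  using assms by (auto simp: stabilize_def)

lemma stabilize_mult:
  assumes "M \<in> carrier_mat n n" "N \<in> carrier_mat n n"
  shows "stabilize (M * N) = stabilize M * stabilize N"
  using assms unfolding stabilize_def
  by (subst mult_four_block_mat[of _ 1 1 _ n _ n _ _ 1 _ n]) auto

lemma stabilize_transpose: "stabilize (M\<^sup>T) = (stabilize M)\<^sup>T"
  unfolding stabilize_def by (subst transpose_four_block_mat[of _ 1 1 _ "dim_col M" _ "dim_row M"]) auto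

lemma stabilize_inject:
  assumes "M \<in> carrier_mat n n" "N \<in> carrier_mat n n" "stabilize M = stabilize N"
  shows "M = N"
proof (rule eq_matI)
  fix i j assume "i < dim_row N" "j < dim_col N"
  then show "M $$ (i, j) = N $$ (i, j)"
    using assms stabilize_index[of M n "Suc i" "Suc j"] stabilize_index[of N n "Suc i" "Suc j"] by auto
qed (use assms in auto)

lemma det_stabilize: "M \<in> carrier_mat n n \<Longrightarrow> det (stabilize M) = det M"
  unfolding stabilize_def by (subst det_four_block_mat_lower_left_zero[of _ 1 _ n]) auto

section \<open>The change of basis to \<open>F4\<close>\<close>

lemma less_5_iff: "(i::nat) < 5 \<longleftrightarrow> i = 0 \<or> i = 1 \<or> i = 2 \<or> i = 3 \<or> i = 4"
  by auto

lemma atLeastLessThan_5: "{0..<5::nat} = {0, 1, 2, 3, 4}"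
  by auto

text \<open>The block of \<open>frame m\<close> comes from \<open>b\<^sup>2 - a\<^sup>2 = m * (y\<^sup>2 - x\<^sup>2)\<close> for \<open>b - a = y - x\<close>,
  \<open>b + a = m * (y + x)\<close>. Index 0 of the source is the extra coordinate \<open>y\<close>, index 1 the negative
  coordinate \<open>x\<close> of \<open>Q' m\<close>.\<close>

definition frame :: "int \<Rightarrow> real mat" where
  "frame m = mat 5 5 (\<lambda>(i, j). if i < 2 \<and> j < 2 then (if i = j then (m - 1) / 2 else (m + 1) / 2)
     else if i = j then 1 else 0)"

text \<open>The 2 by 2 block of \<open>frame m\<close> has determinant \<open>- m\<close>, which is
  the source of the denominators.\<close>

definition frame_inv :: "int \<Rightarrow> real mat" where
  "frame_inv m = mat 5 5 (\<lambda>(i, j). if i < 2 \<and> j < 2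
     then (if i = j then - (m - 1) / (2 * m) else (m + 1) / (2 * m))
     else if i = j then 1 else 0)"

lemma frame_carrier [simp]: "frame m \<in> carrier_mat 5 5" "frame_inv m \<in> carrier_mat 5 5"
  by (simp_all add: frame_def frame_inv_def)

lemma frame_mult_inv: "m \<noteq> 0 \<Longrightarrow> frame m * frame_inv m = 1\<^sub>m 5"
  by (rule eq_matI)
    (auto simp: frame_def frame_inv_def scalar_prod_def less_5_iff atLeastLessThan_5 field_simps)

text \<open>The first two columns of \<open>frame m\<close> are orthogonal for \<open>F4\<close> and
  take the values \<open>m\<close> and \<open>- m\<close>; the other columns are standard basis
  vectors.\<close>

lemma frame_congruence:
  "(frame m)\<^sup>T * form_matrix F4 * frame m = form_matrix (real_of_int m # Q' m)"
proof -
  have F: "form_matrix F4 = mat_diag 5 (\<lambda>i. F4 ! i)"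
    "form_matrix (real_of_int m # Q' m) = mat_diag 5 (\<lambda>i. (real_of_int m # Q' m) ! i)"
    by (simp_all add: form_matrix_def F4_def Q'_def eval_nat_numeral)
  have "(frame m)\<^sup>T * form_matrix F4 * frame m = (frame m)\<^sup>T * (form_matrix F4 * frame m)"
    unfolding F by (rule assoc_mult_mat[of _ 5 5 _ 5 _ 5]) auto
  also have "\<dots> = form_matrix (real_of_int m # Q' m)"
    unfolding F mat_diag_mult_left[OF frame_carrier(1)]
    by (rule eq_matI)
      (auto simp: frame_def mat_diag_def scalar_prod_def less_5_iff atLeastLessThan_5 F4_def Q'_def field_simps)
  finally show ?thesis .
qed

section \<open>Isometries under an added coordinate and under conjugation\<close>

lemma form_matrix_Cons:
  "form_matrix (c # cs) = four_block_mat (c \<cdot>\<^sub>m 1\<^sub>m 1) (0\<^sub>m 1 (length cs)) (0\<^sub>m (length cs) 1) (form_matrix cs)"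
  by (rule eq_matI) (auto simp: form_matrix_def mat_diag_def nth_Cons split: nat.split)

lemma stabilize_preserves_form:
  assumes "M \<in> O_real cs"
  shows "(stabilize M)\<^sup>T * form_matrix (c # cs) * stabilize M = form_matrix (c # cs)"
proof -
  let ?n = "length cs"
  note MD = O_realD[OF assms]
  have "(stabilize M)\<^sup>T * form_matrix (c # cs) =
      four_block_mat (c \<cdot>\<^sub>m 1\<^sub>m 1) (0\<^sub>m 1 ?n) (0\<^sub>m ?n 1) (M\<^sup>T * form_matrix cs)"
    using MD(1) unfolding stabilize_transpose[symmetric] unfolding stabilize_def form_matrix_Cons
    by (subst mult_four_block_mat[of _ 1 1 _ ?n _ ?n _ _ 1 _ ?n]) auto
  also have "\<dots> * stabilize M = four_block_mat (c \<cdot>\<^sub>m 1\<^sub>m 1) (0\<^sub>m 1 ?n) (0\<^sub>m ?n 1) (M\<^sup>T * form_matrix cs * M)"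
    using MD(1) unfolding stabilize_def
    by (subst mult_four_block_mat[of _ 1 1 _ ?n _ ?n _ _ 1 _ ?n]) auto
  finally show ?thesis using MD(2) by (simp add: form_matrix_Cons)
qed

text \<open>The factors \<open>P\<close> around \<open>S\<close> regroup into the pulled-back form,
  which \<open>M\<close> fixes; afterwards \<open>P\<close> and \<open>P'\<close> cancel on both
  sides.\<close>

lemma conjugate_preserves_form:
  fixes P :: "real mat"
  assumes carrier: "P \<in> carrier_mat n n" "P' \<in> carrier_mat n n" "M \<in> carrier_mat n n" "S \<in> carrier_mat n n"
    and inv: "P * P' = 1\<^sub>m n" and M: "M\<^sup>T * (P\<^sup>T * S * P) * M = P\<^sup>T * S * P"
  shows "(P * M * P')\<^sup>T * S * (P * M * P') = S"
proof -
  have inv': "P'\<^sup>T * P\<^sup>T = 1\<^sub>m n" using inv carrier by (metis transpose_mult transpose_one)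
  have "(P * M * P')\<^sup>T = P'\<^sup>T * M\<^sup>T * P\<^sup>T"
    using carrier by (simp add: transpose_mult[of _ n n _ n] assoc_mult_mat[of _ n n _ n _ n])
  then have "(P * M * P')\<^sup>T * S * (P * M * P') = P'\<^sup>T * (M\<^sup>T * (P\<^sup>T * S * P) * M) * P'"
    using carrier by (simp add: assoc_mult_mat[of _ n n _ n _ n])
  also have "\<dots> = (P'\<^sup>T * P\<^sup>T) * S * (P * P')"
    unfolding M using carrier by (simp add: assoc_mult_mat[of _ n n _ n _ n])
  also have "\<dots> = S" unfolding inv inv' using carrier by simp
  finally show ?thesis .
qed

lemma halves_mult_Ints:
  fixes A B :: "real mat"
  assumes "A \<in> carrier_mat n n" "B \<in> carrier_mat n n" "i < n" "j < n"
    and "\<And>i j. i < n \<Longrightarrow> j < n \<Longrightarrow> A $$ (i, j) \<in> \<int>"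
    and "\<And>i j. i < n \<Longrightarrow> j < n \<Longrightarrow> B $$ (i, j) / 2 \<in> \<int>"
  shows "(A * B) $$ (i, j) / 2 \<in> \<int>"
proof -
  have "(A * B) $$ (i, j) / 2 = (\<Sum>k<n. A $$ (i, k) * (B $$ (k, j) / 2))"
    using assms(1-4) by (simp add: scalar_prod_def sum_divide_distrib lessThan_atLeast0)
  also have "\<dots> \<in> \<int>" using assms(3-6) by (intro Ints_sum Ints_mult) auto
  finally show ?thesis .
qed

section \<open>The embedding and its image\<close>

definition F4_embed :: "int \<Rightarrow> real mat \<Rightarrow> real mat" where
  "F4_embed m M = frame m * stabilize M * frame_inv m"

lemma length_Q' [simp]: "length (Q' m) = 4"
  by (simp add: Q'_def)

lemma length_F4 [simp]: "length F4 = 5"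
  by (simp add: F4_def)

lemmas square_5 = left_mult_one_mat[of _ 5 5] right_mult_one_mat[of _ 5 5] assoc_mult_mat[of _ 5 5 _ 5 _ 5] mult_carrier_mat[of _ 5 5 _ 5]

context
  fixes m :: int
  assumes m: "0 < m" "odd m"
begin

lemma frame_inv_mult: "frame_inv m * frame m = 1\<^sub>m 5"
  using mat_mult_left_right_inverse[OF frame_carrier(1,2) frame_mult_inv] m by simp

lemma stabilize_carrier_5 [simp]: "M \<in> carrier_mat 4 4 \<Longrightarrow> stabilize M \<in> carrier_mat 5 5"
  using stabilize_carrier[of M 4] by simp

lemma F4_embed_carrier [simp]: "M \<in> carrier_mat 4 4 \<Longrightarrow> F4_embed m M \<in> carrier_mat 5 5"
  by (simp add: F4_embed_def square_5)

lemma F4_embed_mult: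
  assumes "M \<in> carrier_mat 4 4" "N \<in> carrier_mat 4 4"
  shows "F4_embed m (M * N) = F4_embed m M * F4_embed m N"
proof -
  have "F4_embed m M * F4_embed m N
      = frame m * stabilize M * (frame_inv m * frame m) * stabilize N * frame_inv m"
    unfolding F4_embed_def using assms by (simp add: square_5)
  also have "\<dots> = F4_embed m (M * N)"
    unfolding frame_inv_mult F4_embed_def stabilize_mult[OF assms]
    using assms by (simp add: square_5)
  finally show ?thesis by simp
qed

lemma F4_embed_inject:
  assumes "M \<in> carrier_mat 4 4" "N \<in> carrier_mat 4 4" "F4_embed m M = F4_embed m N"
  shows "M = N"
proof -
  have "frame_inv m * F4_embed m A * frame m = stabilize A" if "A \<in> carrier_mat 4 4" for A
  proof -
    have "frame_inv m * F4_embed m A * frame m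
        = (frame_inv m * frame m) * stabilize A * (frame_inv m * frame m)"
      unfolding F4_embed_def using that by (simp add: square_5)
    then show ?thesis unfolding frame_inv_mult using that by (simp add: square_5)
  qed
  then have "stabilize M = stabilize N" using assms by metis
  with assms(1,2) show ?thesis by (rule stabilize_inject)
qed

lemma det_F4_embed: "M \<in> carrier_mat 4 4 \<Longrightarrow> det (F4_embed m M) = det M"
proof -
  assume M: "M \<in> carrier_mat 4 4"
  have "similar_mat (F4_embed m M) (stabilize M)"
    using M m frame_mult_inv[of m] frame_inv_mult
    by (intro similar_matI[of _ _ "frame m" "frame_inv m" 5]) (auto simp: F4_embed_def square_5)
  then show ?thesis using M by (simp add: det_similar det_stabilize)
qed

text \<open>This determines the sign of the corner entry: its value is 1 for
  \<open>M $$ (0, 0) = 1\<close> and increases with \<open>M $$ (0, 0)\<close>.\<close>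

lemma F4_embed_corner:
  assumes M: "M \<in> carrier_mat 4 4"
  shows "F4_embed m M $$ (0, 0) = ((m + 1)\<^sup>2 * M $$ (0, 0) - (m - 1)\<^sup>2) / (4 * m)"
proof -
  have st: "stabilize M \<in> carrier_mat 5 5" using M by simp
  have "F4_embed m M $$ (0, 0) = (\<Sum>l<5. (\<Sum>k<5. frame m $$ (0, k) * stabilize M $$ (k, l)) * frame_inv m $$ (l, 0))"
  proof -
    have "frame m * stabilize M \<in> carrier_mat 5 5" using M by (simp add: square_5)
    then show ?thesis
      unfolding F4_embed_def using st carrier_matD[OF frame_carrier(1)] carrier_matD[OF frame_carrier(2)]
      by (simp add: scalar_prod_def lessThan_atLeast0)
  qed
  also have "\<dots> = ((m + 1)\<^sup>2 * M $$ (0, 0) - (m - 1)\<^sup>2) / (4 * m)"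
    using M m by (simp add: lessThan_atLeast0 atLeastLessThan_5 frame_def frame_inv_def
      stabilize_index[OF M] power2_eq_square field_simps)
  finally show ?thesis .
qed

text \<open>Since \<open>frame m\<close> is integral, it suffices that
  \<open>?E * frame_inv m\<close> has even entries; \<open>col\<close> makes up for the denominators
  that occur there.\<close>

lemma F4_embed_minus_one_even:
  assumes M: "M \<in> carrier_mat 4 4"
    and even: "\<And>i j. i < 4 \<Longrightarrow> j < 4 \<Longrightarrow> (M $$ (i, j) - 1\<^sub>m 4 $$ (i, j)) / 2 \<in> \<int>"
    and col: "\<And>i. i < 4 \<Longrightarrow> (M $$ (i, 0) - 1\<^sub>m 4 $$ (i, 0)) / m \<in> \<int>"
    and ij: "i < 5" "j < 5"
  shows "(F4_embed m M $$ (i, j) - 1\<^sub>m 5 $$ (i, j)) / 2 \<in> \<int>"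
proof -
  let ?E = "stabilize M - 1\<^sub>m 5"
  have E: "?E \<in> carrier_mat 5 5" by (intro minus_carrier_mat) simp
  have "F4_embed m M - 1\<^sub>m 5 = F4_embed m M - frame m * 1\<^sub>m 5 * frame_inv m"
    using m frame_mult_inv[of m] by (simp add: right_mult_one_mat[of _ 5 5])
  also have "\<dots> = frame m * (?E * frame_inv m)"
    unfolding F4_embed_def using M
    by (simp add: mult_minus_distrib_mat[of _ 5 5 _ 5] minus_mult_distrib_mat[of _ 5 5 _ _ 5]
        square_5)
  finally have eq: "F4_embed m M - 1\<^sub>m 5 = frame m * (?E * frame_inv m)" .
  have frame_Ints: "frame m $$ (i, j) \<in> \<int>" if "i < 5" "j < 5" for i j
  proof -
    obtain c where "m = 2 * c + 1" using m by (elim oddE)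
    then have "(real_of_int m - 1) / 2 = of_int c" "(real_of_int m + 1) / 2 = of_int (c + 1)" by auto
    then have "(real_of_int m - 1) / 2 \<in> \<int>" "(real_of_int m + 1) / 2 \<in> \<int>" by (metis Ints_of_int)+
    then show ?thesis using that by (simp add: frame_def)
  qed
  \<comment> \<open>The factor clears the denominators of row \<open>k\<close>: \<open>m\<close>
    times row 1 consists of entries of \<open>frame m\<close> up to sign, and later rows are those
    of the identity. Row 0 is left out, as it only meets the zero column of
    \<open>?E\<close>.\<close>
  have frame_inv_Ints: "real_of_int (if k = 1 then m else 1) * frame_inv m $$ (k, j) \<in> \<int>" if "0 < k" "k < 5" "j < 5" for k j
    using frame_Ints[OF that(2,3)] Ints_minus[OF frame_Ints[of 0 0]] that m
    by (auto simp: frame_def frame_inv_def minus_divide_left)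
  \<comment> \<open>Column 1 of \<open>?E\<close> is the first column of \<open>M - 1\<close> below
    a zero. Its entries are divisible by 2 and by \<open>m\<close>, which are coprime as
    \<open>m\<close> is odd.\<close>
  have E_Ints: "?E $$ (i, k) / (2 * real_of_int (if k = 1 then m else 1)) \<in> \<int>" if "0 < k" "i < 5" "k < 5" for i k
  proof (cases i)
    case (Suc i')
    obtain k' where k: "k = Suc k'" using \<open>0 < k\<close> gr0_implies_Suc by blast
    have e: "?E $$ (i, k) = M $$ (i', k') - 1\<^sub>m 4 $$ (i', k')"
      using that k Suc M by (simp add: stabilize_index)
    have "(M $$ (i', 0) - 1\<^sub>m 4 $$ (i', 0)) / real_of_int (2 * m) \<in> \<int>"
      using that Suc even[of i' 0] col[of i'] m by (intro Ints_divide_coprime) auto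
    then show ?thesis using even[of i' k'] e that k Suc by (cases "k' = 0") auto
  qed (use that M in \<open>simp add: stabilize_index\<close>)
  have "(?E * frame_inv m) $$ (i, j) / 2 \<in> \<int>" if ij: "i < 5" "j < 5" for i j
  proof -
    have "?E $$ (i, k) * frame_inv m $$ (k, j) / 2 \<in> \<int>" if k: "k < 5" for k
    proof (cases "k = 0")
      case True
      then show ?thesis using ij M by (simp add: stabilize_index)
    next
      case False
      let ?c = "real_of_int (if k = 1 then m else 1)"
      \<comment> \<open>The denominator \<open>?c\<close> is moved from \<open>frame_inv m\<close>
        to \<open>?E\<close>, whose entry it divides.\<close>
      have "?E $$ (i, k) * frame_inv m $$ (k, j) / 2
          = ?E $$ (i, k) / (2 * ?c) * (?c * frame_inv m $$ (k, j))" using m by simp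
      also have "\<dots> \<in> \<int>"
      proof (rule Ints_mult)
        show "?E $$ (i, k) / (2 * ?c) \<in> \<int>" using False ij k by (intro E_Ints) auto
        show "?c * frame_inv m $$ (k, j) \<in> \<int>" using False ij k by (intro frame_inv_Ints) auto
      qed
      finally show ?thesis .
    qed
    then have "(\<Sum>k<5. ?E $$ (i, k) * frame_inv m $$ (k, j) / 2) \<in> \<int>"
      by (intro Ints_sum) (simp del: index_minus_mat)
    moreover have "(?E * frame_inv m) $$ (i, j) / 2 = (\<Sum>k<5. ?E $$ (i, k) * frame_inv m $$ (k, j) / 2)"
      using E carrier_matD[OF frame_carrier(2)] ij
      by (simp add: scalar_prod_def sum_divide_distrib lessThan_atLeast0 del: index_minus_mat)
    ultimately show ?thesis by (simp only:)
  qed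
  with E ij frame_Ints have "(frame m * (?E * frame_inv m)) $$ (i, j) / 2 \<in> \<int>"
    by (intro halves_mult_Ints[of _ 5 "?E * frame_inv m"] mult_carrier_mat[OF E]) simp_all
  moreover have "(F4_embed m M - 1\<^sub>m 5) $$ (i, j) = F4_embed m M $$ (i, j) - 1\<^sub>m 5 $$ (i, j)"
    using ij by simp
  ultimately show ?thesis by (simp add: eq)
qed

text \<open>For \<open>i > 0\<close> the coefficients 1 and \<open>- m\<close> in
  \<open>O_real_inverse_entry\<close> give \<open>M $$ (i, 0) = - m * W $$ (0, i)\<close> with the
  integral inverse \<open>W\<close>.\<close>

lemma Delta_column:
  assumes M: "M \<in> Delta m" and i: "i < 4"
  shows "(M $$ (i, 0) - 1\<^sub>m 4 $$ (i, 0)) / m \<in> \<int>"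
proof (cases "i = 0")
  case True
  then show ?thesis using M m by (simp add: Delta_def rcong_iff_Ints)
next
  case False
  have "M \<in> O_real (Q' m)" "M \<in> GL_int 4"
    using M by (auto simp: Delta_def SO_plus_int_def SO_plus_real_def O_plus_real_def)
  moreover from this(2) obtain W where "W \<in> carrier_mat 4 4" "M * W = 1\<^sub>m 4"
      "\<And>i j. i < 4 \<Longrightarrow> j < 4 \<Longrightarrow> W $$ (i, j) \<in> \<int>"
    by (elim GL_intE) blast
  ultimately have "Q' m ! i * M $$ (i, 0) = W $$ (0, i) * Q' m ! 0" "W $$ (0, i) \<in> \<int>"
    using O_real_inverse_entry[of M "Q' m" W i 0] i by auto
  moreover have "Q' m ! i = 1" using i False by (auto simp: Q'_def nth_Cons split: nat.split)
  ultimately have "M $$ (i, 0) / m = - W $$ (0, i)" "W $$ (0, i) \<in> \<int>"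
    using m by (auto simp: Q'_def)
  then show ?thesis using i False by simp
qed

lemma F4_embed_mem:
  assumes "M \<in> congruence_subgroup2 4 (Delta m)"
  shows "F4_embed m M \<in> congruence_subgroup2 5 (SO_plus_int F4)"
proof -
  have D: "M \<in> Delta m" and even: "\<And>i j. i < 4 \<Longrightarrow> j < 4 \<Longrightarrow> (M $$ (i, j) - 1\<^sub>m 4 $$ (i, j)) / 2 \<in> \<int>"
    using assms by (auto simp: congruence_subgroup2_def rcong_iff_Ints simp del: index_one_mat)
  have MO: "M \<in> O_plus_real (Q' m)" and det: "det M = 1" and GL: "M \<in> GL_int 4"
    using D by (auto simp: Delta_def SO_plus_int_def SO_plus_real_def)
  have MR: "M \<in> O_real (Q' m)" using MO by (simp add: O_plus_real_def)
  have M: "M \<in> carrier_mat 4 4" using O_realD(1)[OF MR] by simp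
  have halves: "(F4_embed m M $$ (i, j) - 1\<^sub>m 5 $$ (i, j)) / 2 \<in> \<int>" if "i < 5" "j < 5" for i j
    using F4_embed_minus_one_even[OF M even Delta_column[OF D] that] by blast
  have Ints: "F4_embed m M $$ (i, j) \<in> \<int>" if ij: "i < 5" "j < 5" for i j
  proof -
    have "F4_embed m M $$ (i, j) = 2 * ((F4_embed m M $$ (i, j) - 1\<^sub>m 5 $$ (i, j)) / 2) + 1\<^sub>m 5 $$ (i, j)"
      by (simp add: field_simps)
    also have "\<dots> \<in> \<int>" using halves[OF ij] ij by (intro Ints_add Ints_mult) auto
    finally show ?thesis .
  qed
  have det': "det (F4_embed m M) = 1" using det_F4_embed[OF M] det by simp
  have F4: "form_matrix F4 \<in> carrier_mat 5 5" using form_matrix_carrier[of F4] by simp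
  \<comment> \<open>The added coordinate gets the coefficient \<open>m\<close>, so the form fixed by
    \<open>stabilize M\<close> is the pullback of \<open>F4\<close> along
    \<open>frame m\<close>.\<close>
  have "(F4_embed m M)\<^sup>T * form_matrix F4 * F4_embed m M = form_matrix F4"
    unfolding F4_embed_def
    using M m F4 frame_mult_inv[of m] stabilize_preserves_form[OF MR, of m]
    by (intro conjugate_preserves_form[of _ 5]) (auto simp: frame_congruence)
  then have O: "F4_embed m M \<in> O_real F4"
    using M det' by (intro O_realI) auto
  have "M $$ (0, 0) > 0"
    using O_plus_real_corner_pos[OF MO] m by (simp add: Q'_def)
  \<comment> \<open>Integrality raises positivity to the bound 1, which makes the numerator in
    \<open>F4_embed_corner\<close> positive.\<close>
  moreover have "M $$ (0, 0) \<in> \<int>" using GL by (elim GL_intE) auto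
  ultimately have "1 \<le> M $$ (0, 0)" by (auto elim!: Ints_cases)
  then have "(real_of_int m - 1)\<^sup>2 < (m + 1)\<^sup>2 * M $$ (0, 0)"
    using m mult_left_mono[of 1 "M $$ (0, 0)" "(real_of_int m + 1)\<^sup>2"]
    by (simp add: power2_eq_square algebra_simps)
  then have "0 < F4_embed m M $$ (0, 0)" using m by (simp add: F4_embed_corner[OF M])
  moreover have "F4 = - 1 # replicate 4 1" by (simp add: F4_def eval_nat_numeral)
  ultimately have "F4_embed m M \<in> O_plus_real F4" using O O_plus_realI[of "F4_embed m M" 4] by simp
  moreover have "F4_embed m M \<in> GL_int 5" using M Ints det' by (intro GL_intI) auto
  ultimately show ?thesis
    using halves det' by (simp add: congruence_subgroup2_def SO_plus_int_def SO_plus_real_def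
      rcong_iff_Ints del: index_one_mat)
qed

end

theorem proposition5p3:
  fixes m k :: int
  assumes "prime m" and "m = 8 * k - 1"
  shows "group_embeds
    (matrix_group 4 (congruence_subgroup2 4 (Delta m)))
    (matrix_group 5 (congruence_subgroup2 5 (SO_plus_int F4)))"
proof -
  let ?G = "congruence_subgroup2 4 (Delta m)"
  \<comment> \<open>Oddness makes \<open>frame m\<close> integral and 2 coprime to
    \<open>m\<close>.\<close>
  have m: "0 < m" "odd m" using assms prime_gt_0_int[of m] by auto
  have carrier: "M \<in> carrier_mat 4 4" if "M \<in> ?G" for M
    using that O_realD(1)[of M "Q' m"]
    by (auto simp: congruence_subgroup2_def Delta_def SO_plus_int_def SO_plus_real_def O_plus_real_def)
  have "inj_on (F4_embed m) ?G"
    by (rule inj_onI) (rule F4_embed_inject[OF m carrier carrier])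
  moreover have "F4_embed m \<in> hom (matrix_group 4 ?G) (matrix_group 5 (congruence_subgroup2 5 (SO_plus_int F4)))"
    by (rule homI)
      (simp_all add: matrix_group_def GL_real_def units_of_def ring_mat_simps F4_embed_mem[OF m] F4_embed_mult[OF m] carrier)
  ultimately have "F4_embed m \<in> mon (matrix_group 4 ?G) (matrix_group 5 (congruence_subgroup2 5 (SO_plus_int F4)))"
    by (simp add: mon_def matrix_group_def)
  then show ?thesis unfolding group_embeds_def by blast
qed

end
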